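(* Let $p$ be a prime and let $0\ne\kappa\in\overline{\mathbb Q}\subseteq\overline{\mathbb Q_p}$ be such that $|\kappa|_p\ne1$. Then there exists a strict sequence $(\alpha_n)_{n\in\mathbb N}$ of algebraic numbers such that no $\alpha_n$ is a conjugate of $\kappa$, $\lim_{n\to\infty}h(\alpha_n)=0$ and $$\lim_{n\to\infty}\left|\frac{1}{[\mathbb Q(\alpha_n):\mathbb Q]}\sum_{\sigma:\mathbb Q(\alpha_n)\to\overline{\mathbb Q_p}}\log|\sigma(\alpha_n)-\kappa|_p-\log\max\{1,|\kappa|_p\}\right|=|\log|\kappa|_p|>0,$$ where the sum runs over all field embeddings $\sigma:\mathbb Q(\alpha_n)\to\overline{\mathbb Q_p}$.
   Context: $\overline{\mathbb Q_p}$ is an algebraic closure of $\mathbb Q_p$, $|\cdot|_p$ is the unique extension to $\overline{\mathbb Q_p}$ of the $p$-adic absolute value normalized by $|p|_p=1/p$, and $\overline{\mathbb Q}$ is the algebraic closure of $\mathbb Q$ in $\overline{\mathbb Q_p}$. For $P\in\mathbb Z[X]\setminus\{0\}$ let $m(P)=\int_0^1\log|P(e^{2\pi i t})|\,dt$ (complex absolute value). For an algebraic number $\alpha$, its $\mathbb Z$-minimal polynomial is the unique irreducible $P=a_DX^D+\dots+a_0\in\mathbb Z[X]$ with $P(\alpha)=0$ and $a_D\ge1$; the absolute logarithmic Weil height is $h(\alpha)=m(P)/D$. A sequence $(\alpha_n)_{n\in\mathbb N}$ of algebraic numbers is called strict if for every $\alpha\in\overline{\mathbb Q}$ there are at most finitely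 many $n$ with $\alpha_n=\alpha$. Two algebraic numbers are conjugate if they have the same minimal polynomial over $\mathbb Q$. *)

theory Defs
  imports "HOL-Analysis.Analysis" "HOL-Computational_Algebra.Computational_Algebra"
begin

definition padic_abs_rat :: "nat \<Rightarrow> rat \<Rightarrow> real" where
  "padic_abs_rat p x =
     (if x = 0 then 0
      else case quotient_of x of (a, b) \<Rightarrow>
        real p powi (int (multiplicity (int p) b) - int (multiplicity (int p) a)))"

definition absolute_value :: "('k::field \<Rightarrow> real) \<Rightarrow> bool" where
  "absolute_value v \<longleftrightarrow>
     (\<forall>x. v x \<ge> 0) \<and> (\<forall>x. v x = 0 \<longleftrightarrow> x = 0) \<and>
     (\<forall>x y. v (x * y) = v x * v y) \<and> (\<forall>x y. v (x + y) \<le> v x + v y)"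

definition complete_wrt :: "('k::field \<Rightarrow> real) \<Rightarrow> bool" where
  "complete_wrt v \<longleftrightarrow>
     (\<forall>s :: nat \<Rightarrow> 'k.
        (\<forall>e>0. \<exists>N. \<forall>m\<ge>N. \<forall>n\<ge>N. v (s m - s n) < e) \<longrightarrow>
        (\<exists>l. (\<lambda>n. v (s n - l)) \<longlonglongrightarrow> 0))"

text \<open>
  The field \<open>'q\<close> with absolute value \<open>v\<close> is the field of \<open>p\<close>-adic numbers: the completion
  of the rationals (embedded by \<^const>\<open>of_rat\<close>) with respect to the \<open>p\<close>-adic absolute value.
  This determines \<open>('q, v)\<close> up to a unique isometric isomorphism.
\<close>

definition padic_field :: "nat \<Rightarrow> ('q::field_char_0 \<Rightarrow> real) \<Rightarrow> bool" where
  "padic_field p v \<longleftrightarrow>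
     absolute_value v \<and>
     (\<forall>r. v (of_rat r) = padic_abs_rat p r) \<and>
     complete_wrt v \<and>
     (\<forall>x. \<forall>e>0. \<exists>r. v (x - of_rat r) < e)"

definition field_embedding :: "('q::field \<Rightarrow> 'a::field) \<Rightarrow> bool" where
  "field_embedding \<iota> \<longleftrightarrow>
     \<iota> 1 = 1 \<and> (\<forall>x y. \<iota> (x + y) = \<iota> x + \<iota> y) \<and> (\<forall>x y. \<iota> (x * y) = \<iota> x * \<iota> y)"

text \<open>
  That \<open>'a\<close> is algebraically closed is expressed by its type class; \<open>\<iota>\<close> makes it an algebraic
  extension of \<open>'q\<close>.
\<close>

definition algebraic_closure_of :: "('q::field \<Rightarrow> 'a::alg_closed_field) \<Rightarrow> bool" where
  "algebraic_closure_of \<iota> \<longleftrightarrow>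
     field_embedding \<iota> \<and>
     (\<forall>x. \<exists>f. f \<noteq> 0 \<and> poly (map_poly \<iota> f) x = 0)"

definition extends_abs ::
    "('q::field \<Rightarrow> 'a::field) \<Rightarrow> ('q \<Rightarrow> real) \<Rightarrow> ('a \<Rightarrow> real) \<Rightarrow> bool" where
  "extends_abs \<iota> v w \<longleftrightarrow> absolute_value w \<and> (\<forall>x. w (\<iota> x) = v x)"

definition log_mahler :: "int poly \<Rightarrow> real" where
  "log_mahler P =
     integral {0..1}
       (\<lambda>t::real. ln (cmod (poly (map_poly of_int P) (exp (2 * of_real pi * \<i> * of_real t)))))"

text \<open>
  Irreducibility in \<^typ>\<open>int poly\<close> includes that the content is a unit.
\<close>

definition int_minpoly :: "'a::field_char_0 \<Rightarrow> int poly" where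
  "int_minpoly \<alpha> =
     (THE P. irreducible P \<and> poly (map_poly of_int P) \<alpha> = 0 \<and> lead_coeff P \<ge> 1)"

definition weil_height :: "'a::field_char_0 \<Rightarrow> real" where
  "weil_height \<alpha> = log_mahler (int_minpoly \<alpha>) / real (degree (int_minpoly \<alpha>))"

definition rat_minpoly :: "'a::field_char_0 \<Rightarrow> rat poly" where
  "rat_minpoly \<alpha> =
     (THE P. irreducible P \<and> poly (map_poly of_rat P) \<alpha> = 0 \<and> lead_coeff P = 1)"

definition conjugates :: "'a::field_char_0 \<Rightarrow> 'a \<Rightarrow> bool" where
  "conjugates \<alpha> \<beta> \<longleftrightarrow> algebraic \<alpha> \<and> algebraic \<beta> \<and> rat_minpoly \<alpha> = rat_minpoly \<beta>"

definition strict_seq :: "(nat \<Rightarrow> 'a::field_char_0) \<Rightarrow> bool" where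
  "strict_seq a \<longleftrightarrow> (\<forall>\<beta>. algebraic \<beta> \<longrightarrow> finite {n. a n = \<beta>})"

definition is_subfield :: "'a::field set \<Rightarrow> bool" where
  "is_subfield F \<longleftrightarrow>
     1 \<in> F \<and> (\<forall>x\<in>F. \<forall>y\<in>F. x - y \<in> F) \<and> (\<forall>x\<in>F. \<forall>y\<in>F. x * y \<in> F) \<and>
     (\<forall>x\<in>F. inverse x \<in> F)"

text \<open>
  In characteristic zero the prime field is \<open>\<rat>\<close>, so the smallest subfield containing \<open>\<alpha>\<close>
  is \<open>\<rat>(\<alpha>)\<close>.
\<close>

definition rat_adjoin :: "'a::field_char_0 \<Rightarrow> 'a set" where
  "rat_adjoin \<alpha> = is_subfield hull {\<alpha>}"

definition rat_degree :: "'a::field_char_0 set \<Rightarrow> nat" where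
  "rat_degree F = vector_space.dim (\<lambda>(r::rat) x. of_rat r * x) F"

text \<open>
  Embeddings are functions on the whole type taking the fixed value \<^const>\<open>undefined\<close>
  outside \<open>F\<close>, so that each field embedding of \<open>F\<close> is counted exactly once.
\<close>

definition embeddings :: "'a::field set \<Rightarrow> ('a \<Rightarrow> 'b::field) set" where
  "embeddings F =
     {\<sigma> \<in> extensional F. \<sigma> 1 = 1 \<and>
        (\<forall>x\<in>F. \<forall>y\<in>F. \<sigma> (x + y) = \<sigma> x + \<sigma> y) \<and>
        (\<forall>x\<in>F. \<forall>y\<in>F. \<sigma> (x * y) = \<sigma> x * \<sigma> y)}"

end

theory Submission
  imports Defs "HOL-Complex_Analysis.Cauchy_Integral_Formula"
    "HOL-Computational_Algebra.Field_as_Ring"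
begin

text \<open>
  If \<open>P\<close> is the minimal polynomial of \<open>\<alpha>\<close> over \<open>\<int>\<close>, with degree \<open>D\<close> and leading coefficient \<open>a\<close>,
  then the embeddings of \<open>\<rat>(\<alpha>)\<close> send \<open>\<alpha>\<close> to the \<open>D\<close> distinct roots of \<open>P\<close>, and the average in the
  theorem equals \<open>ln (|P(\<kappa>)| / |a|) / D\<close> (\<open>sum_ln_embeddings\<close>), with the \<open>p\<close>-adic absolute
  value. So it suffices to find irreducible
  integer polynomials of growing degree and bounded Mahler measure whose value at \<open>\<kappa>\<close> is atypical.

  Let \<open>B \<in> \<int>[X]\<close> vanish at \<open>\<kappa>\<close> with \<open>B(0) \<noteq> 0\<close>, and let \<open>q\<close> be a prime that does not divide \<open>B(0)\<close>.
  For \<open>m > degree B\<close> the polynomial \<open>X\<^sup>m + q B\<close> is Eisenstein at \<open>q\<close>, hence irreducible. Its value at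
  \<open>\<kappa>\<close> is \<open>\<kappa>\<^sup>m\<close>, so the average is \<open>ln |\<kappa>|\<close> for every \<open>m\<close>. If \<open>|\<kappa>| < 1\<close>, this differs from the
  expected \<open>ln (max 1 |\<kappa>|) = 0\<close> by \<open>|ln |\<kappa>||\<close>. If \<open>|\<kappa>| > 1\<close>, the same construction for \<open>1/\<kappa>\<close>
  followed by passing to reciprocal polynomials gives polynomials with value \<open>1\<close> at \<open>\<kappa>\<close> and
  fixed leading coefficient \<open>q B(0)\<close>. Now the average tends to \<open>0\<close>, again at distance \<open>|ln |\<kappa>||\<close>
  from \<open>ln (max 1 |\<kappa>|)\<close>.

  On the unit circle these polynomials are bounded by a constant \<open>C\<close>, so their logarithmic Mahler
  measure is at most \<open>ln C\<close>. It is nonnegative by Jensen's formula (\<open>log_mahler_bounds\<close>), in which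
  no singularities occur: an irreducible integer polynomial with a root on the circle is
  self-reciprocal up to sign (\<open>irreducible_no_root_on_circle\<close>), while the leading and the constant
  coefficient are here \<open>1\<close> and \<open>q B(0)\<close> in one order or the other, and \<open>q B(0) > 1\<close> when \<open>B\<close> is
  normalized by \<open>B(0) > 0\<close>. Dividing by the degree, the heights tend to zero.
\<close>

section \<open>Integer and rational polynomials in characteristic zero\<close>

abbreviation ipoly :: "int poly \<Rightarrow> 'a::ring_1 poly" where
  "ipoly \<equiv> map_poly of_int"

abbreviation rpoly :: "rat poly \<Rightarrow> 'a::field_char_0 poly" where
  "rpoly \<equiv> map_poly of_rat"

lemma map_poly_hom_add:
  assumes "f 0 = 0" "\<And>x y. f (x + y) = f x + f y"
  shows "map_poly f (p + q) = map_poly f p + map_poly f q"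
  by (intro poly_eqI) (simp add: coeff_map_poly assms)

lemma map_poly_hom_mult:
  fixes f :: "'a::comm_semiring_0 \<Rightarrow> 'b::comm_semiring_0"
  assumes "f 0 = 0" "\<And>x y. f (x + y) = f x + f y" "\<And>x y. f (x * y) = f x * f y"
  shows "map_poly f (p * q) = map_poly f p * map_poly f q"
proof (intro poly_eqI)
  fix n
  have "f (sum g A) = (\<Sum>x\<in>A. f (g x))" for g :: "nat \<Rightarrow> 'a" and A
    using sum_comp_morphism[of f g A] assms by (simp add: o_def)
  then show "coeff (map_poly f (p * q)) n = coeff (map_poly f p * map_poly f q) n"
    by (simp add: coeff_map_poly assms coeff_mult)
qed

lemma ipoly_add: "ipoly (P + Q) = (ipoly P + ipoly Q :: 'a::comm_ring_1 poly)"
  by (rule map_poly_hom_add) auto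

lemma ipoly_mult: "ipoly (P * Q) = (ipoly P * ipoly Q :: 'a::comm_ring_1 poly)"
  by (rule map_poly_hom_mult) auto

lemma ipoly_smult: "ipoly (smult c P) = (smult (of_int c) (ipoly P) :: 'a::comm_ring_1 poly)"
  by (rule map_poly_smult) auto

lemma rpoly_add: "rpoly (f + g) = rpoly f + rpoly g"
  by (rule map_poly_hom_add) (auto simp: of_rat_add)

lemma rpoly_diff: "rpoly (f - g) = rpoly f - rpoly g"
  by (intro poly_eqI) (simp add: coeff_map_poly of_rat_diff)

lemma rpoly_mult: "rpoly (f * g) = rpoly f * rpoly g"
  by (rule map_poly_hom_mult) (auto simp: of_rat_add of_rat_mult)

lemma rpoly_smult: "rpoly (smult c f) = smult (of_rat c) (rpoly f)"
  by (rule map_poly_smult) (auto simp: of_rat_mult)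

lemma rpoly_ipoly: "rpoly (ipoly P) = ipoly P"
  by (simp add: map_poly_map_poly o_def)

lemma degree_ipoly [simp]: "degree (ipoly P :: 'a::ring_char_0 poly) = degree P"
  by (rule degree_map_poly) auto

lemma ipoly_eq_0_iff [simp]: "ipoly P = (0 :: 'a::ring_char_0 poly) \<longleftrightarrow> P = 0"
  by (simp add: map_poly_eq_0_iff)

lemma clear_denominators:
  fixes f :: "rat poly"
  shows "\<exists>c F. c \<noteq> 0 \<and> ipoly F = smult (of_int c) f"
proof (induction f)
  case 0
  show ?case by (intro exI[of _ 1] exI[of _ 0]) auto
next
  case (pCons a f)
  then obtain c F where cF: "c \<noteq> 0" "ipoly F = smult (of_int c) f"
    by blast
  obtain u w where uw: "quotient_of a = (u, w)" by fastforce
  then have w: "w > 0" "a = of_int u / of_int w"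
    by (auto simp: quotient_of_denom_pos quotient_of_div)
  have "ipoly (pCons (u * c) (smult w F)) = smult (of_int (w * c)) (pCons a f)"
    using w cF by (simp add: map_poly_pCons ipoly_smult)
  then show ?case
    using w cF(1) by (metis mult_eq_0_iff less_irrefl)
qed

text \<open>
  The ideal of integer polynomials vanishing at an algebraic \<open>\<alpha>\<close> is principal, although
  \<open>\<int>[X]\<close> is not a principal ideal domain: pseudo-division by the primitive part \<open>M\<close> of an element
  of least degree among the nonzero ones shows that \<open>M\<close> divides a nonzero integer multiple \<open>a Q\<close> of every element \<open>Q\<close>,
  and Gauss's lemma on contents lets the factor \<open>a\<close> be cancelled.
\<close>

lemma int_poly_annihilator:
  fixes \<alpha> :: "'a::field_char_0"
  assumes "algebraic \<alpha>"
  obtains M where "irreducible M" "lead_coeff M \<ge> 1" "poly (ipoly M) \<alpha> = 0"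
    "\<And>Q. poly (ipoly Q) \<alpha> = 0 \<Longrightarrow> M dvd Q"
proof -
  define I where "I Q \<longleftrightarrow> Q \<noteq> 0 \<and> poly (ipoly Q) \<alpha> = 0" for Q
  have "\<exists>Q. I Q"
    using algebraicE'[OF assms] unfolding I_def by metis
  then obtain f where f: "I f" and min: "\<And>Q. I Q \<Longrightarrow> degree f \<le> degree Q"
    by (metis ex_has_least_nat)
  define M where "M = smult (sgn (lead_coeff f)) (primitive_part f)"
  have f0: "f \<noteq> 0" and fr: "poly (ipoly f) \<alpha> = 0" using f by (auto simp: I_def)
  have sg: "sgn (lead_coeff f) \<noteq> 0" "\<bar>sgn (lead_coeff f)\<bar> = 1"
    using f0 by (auto simp: sgn_if)
  have degM: "degree M = degree f" unfolding M_def using sg by simp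
  have cont: "content M = 1"
    unfolding M_def using f0 sg by simp
  have prim: "f = smult (content f) (primitive_part f)" by simp
  have "lead_coeff f = content f * lead_coeff (primitive_part f)"
    by (metis content_times_primitive_part lead_coeff_smult)
  moreover have "content f > 0"
    by (metis content_eq_zero_iff f0 normalize_content normalize_int_def abs_ge_zero order_le_less)
  moreover have "lead_coeff M = sgn (lead_coeff f) * lead_coeff (primitive_part f)"
    unfolding M_def by simp
  ultimately have "lead_coeff M = \<bar>lead_coeff (primitive_part f)\<bar>"
    by (simp add: sgn_mult abs_sgn mult.commute)
  moreover have "lead_coeff (primitive_part f) \<noteq> 0"
    using f0 primitive_part_eq_0_iff leading_coeff_0_iff by blast
  ultimately have lead: "lead_coeff M \<ge> 1" by linarith
  have root: "poly (ipoly M) \<alpha> = 0"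
  proof -
    have "poly (ipoly f) \<alpha> = of_int (content f) * poly (ipoly (primitive_part f)) \<alpha>"
      by (metis prim ipoly_smult poly_smult)
    then show ?thesis
      using fr f0 unfolding M_def by (simp add: ipoly_smult)
  qed
  have M0: "M \<noteq> 0" using lead by auto
  have dvd: "M dvd Q" if Q: "poly (ipoly Q) \<alpha> = 0" for Q
  proof -
    define r where "r = pseudo_mod Q M"
    obtain a S where aS: "a \<noteq> 0" "smult a Q = M * S + r"
      using pseudo_mod(1)[OF M0] r_def by metis
    have "poly (ipoly (smult a Q)) \<alpha> = poly (ipoly (M * S + r)) \<alpha>" using aS(2) by simp
    then have "poly (ipoly r) \<alpha> = 0"
      using Q root by (simp add: ipoly_add ipoly_mult ipoly_smult)
    then have "r = 0"
      using min[of r] degM pseudo_mod(2)[OF M0, of Q] unfolding I_def r_def by fastforce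
    then have eq: "smult a Q = M * S" using aS by simp
    \<comment> \<open>\<open>M\<close> is primitive, so \<open>a\<close> divides the content of the cofactor and can be removed from it.\<close>
    then have "content S = content (smult a Q)" using cont by (simp add: content_mult)
    then have "a dvd content S" by simp
    then have "[:a:] dvd S" by (simp add: const_poly_dvd_iff_dvd_content)
    then obtain T where "S = smult a T" by (auto elim!: dvdE)
    then have "smult a Q = smult a (M * T)" using eq by simp
    then have "Q = M * T" using aS(1) by (metis smult_eq_iff smult_cancel)
    then show ?thesis by simp
  qed
  have "irreducible M"
  proof (rule irreducibleI)
    show "M \<noteq> 0" by (rule M0)
    show "\<not> M dvd 1"
    proof
      assume "M dvd 1"
      then obtain T where "1 = M * T" by (auto elim: dvdE)
      then have "poly (ipoly 1) \<alpha> = poly (ipoly (M * T)) \<alpha>" by simp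
      then show False using root by (simp add: ipoly_mult)
    qed
    fix a b assume ab: "M = a * b"
    then have "poly (ipoly a) \<alpha> * poly (ipoly b) \<alpha> = 0" using root by (simp add: ipoly_mult)
    then have "M dvd a \<or> M dvd b" using dvd by auto
    then show "a dvd 1 \<or> b dvd 1"
      using ab M0
      by (metis dvd_mult_cancel_left dvd_times_left_cancel_iff mult.right_neutral mult.commute mult_eq_0_iff)
  qed
  then show ?thesis using that lead root dvd by blast
qed

lemma poly_eq_of_mutual_dvd:
  fixes p q :: "'a::idom poly"
  assumes "p dvd q" "q dvd p" "lead_coeff p = lead_coeff q"
  shows "p = q"
proof (cases "p = 0")
  case False
  obtain T where T: "q = p * T" using assms(1) by (rule dvdE)
  obtain S where S: "p = q * S" using assms(2) by (rule dvdE)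
  have "p * 1 = p * (T * S)" using T S by (metis mult.assoc mult.right_neutral)
  then have "T * S = 1" using False by (metis mult_left_cancel)
  then have "T dvd 1" by (metis dvd_triv_left)
  then obtain c where c: "T = [:c:]" by (auto simp: is_unit_poly_iff)
  have "lead_coeff q = lead_coeff p * c" by (simp add: T c)
  moreover have "lead_coeff q \<noteq> 0" using False assms(3) by (metis leading_coeff_0_iff)
  ultimately have "c = 1" using assms(3) by simp
  then show ?thesis using T c by (simp add: one_pCons)
qed (use assms in auto)

section \<open>Irreducible integer polynomials as minimal polynomials\<close>

text \<open>
  An irreducible integer polynomial vanishing at \<open>\<alpha>\<close> is, up to sign, the generator of the ideal
  of all integer polynomials vanishing at \<open>\<alpha>\<close>. The element \<open>\<alpha>\<close> is allowed to live in any field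
  of characteristic zero because this is used both for the algebraic numbers of the theorem and
  for complex numbers on the unit circle.
\<close>

locale irreducible_with_root =
  fixes P :: "int poly" and \<alpha> :: "'a::field_char_0"
  assumes irred: "irreducible P" and root: "poly (ipoly P) \<alpha> = 0"
begin

lemma nonzero: "P \<noteq> 0" using irred by auto

lemma algebraic: "algebraic \<alpha>"
  using root nonzero by (intro algebraicI[of "ipoly P"]) (auto simp: coeff_map_poly)

lemma dvd_of_root:
  assumes "poly (ipoly Q) \<alpha> = 0"
  shows "P dvd Q"
proof -
  obtain M where M: "irreducible M" "poly (ipoly M) \<alpha> = 0"
    "\<And>Q. poly (ipoly Q) \<alpha> = 0 \<Longrightarrow> M dvd Q"
    using int_poly_annihilator[OF algebraic] by metis
  obtain T where T: "P = M * T" using M(3)[OF root] by (auto elim: dvdE)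
  then have "T dvd 1" using irred M(1) by (metis irreducibleD irreducible_not_unit)
  then have "P dvd M" using T by simp
  then show ?thesis using M(3)[OF assms] dvd_trans by blast
qed

lemma int_minpoly_eq:
  assumes "lead_coeff P \<ge> 1"
  shows "int_minpoly \<alpha> = P"
  unfolding int_minpoly_def
proof (rule the_equality)
  show "irreducible P \<and> poly (ipoly P) \<alpha> = 0 \<and> lead_coeff P \<ge> 1"
    using irred root assms by blast
  fix Q assume Q: "irreducible Q \<and> poly (ipoly Q) \<alpha> = 0 \<and> lead_coeff Q \<ge> 1"
  then interpret Q: irreducible_with_root Q \<alpha> by unfold_locales auto
  have d: "P dvd Q" "Q dvd P" using Q dvd_of_root Q.dvd_of_root root by auto
  then have "lead_coeff P dvd lead_coeff Q" "lead_coeff Q dvd lead_coeff P"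
    by (metis dvdE dvd_triv_left lead_coeff_mult)+
  then have "lead_coeff Q = lead_coeff P"
    using Q assms by (intro zdvd_antisym_nonneg) auto
  then show "Q = P" using d by (intro poly_eq_of_mutual_dvd) auto
qed

lemma rat_dvd_of_root:
  assumes "poly (rpoly f) \<alpha> = 0"
  shows "ipoly P dvd f"
proof -
  obtain c F where cF: "c \<noteq> 0" "ipoly F = smult (rat_of_int c) f"
    using clear_denominators by blast
  have "poly (ipoly F) \<alpha> = poly (rpoly (ipoly F)) \<alpha>" by (simp add: rpoly_ipoly)
  also have "\<dots> = 0" using assms by (simp add: cF rpoly_smult)
  finally obtain T where "F = P * T" using dvd_of_root by (auto elim: dvdE)
  then have "ipoly P dvd smult (rat_of_int c) f" by (metis cF(2) ipoly_mult dvd_triv_left)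
  then show ?thesis using cF(1) by (simp add: dvd_smult_iff)
qed

lemma rat_root: "poly (rpoly (ipoly P)) \<alpha> = 0"
  using root by (simp add: rpoly_ipoly)

lemma rat_nonunit: "\<not> ipoly P dvd (1 :: rat poly)"
proof
  assume "ipoly P dvd (1 :: rat poly)"
  then obtain T :: "rat poly" where "1 = ipoly P * T" by (rule dvdE)
  then have "poly (rpoly 1) \<alpha> = poly (rpoly (ipoly P * T)) \<alpha>" by simp
  then show False using rat_root by (simp add: rpoly_mult)
qed

text \<open>
  Gauss's lemma, obtained from the root: one factor of a rational factorization of \<open>P\<close>
  vanishes at \<open>\<alpha>\<close>, hence is divisible by \<open>P\<close> over \<open>\<rat>\<close>, and the other factor is a unit.
\<close>

lemma rat_irreducible: "irreducible (ipoly P :: rat poly)"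
proof (rule irreducibleI)
  show P0: "(ipoly P :: rat poly) \<noteq> 0" using nonzero by simp
  show "\<not> ipoly P dvd (1 :: rat poly)" by (rule rat_nonunit)
  fix a b :: "rat poly" assume ab: "ipoly P = a * b"
  then have "poly (rpoly a) \<alpha> * poly (rpoly b) \<alpha> = 0" using rat_root by (simp add: rpoly_mult)
  then have "ipoly P dvd a \<or> ipoly P dvd b" using rat_dvd_of_root by auto
  then show "a dvd 1 \<or> b dvd 1"
    using ab P0
    by (metis dvd_times_left_cancel_iff mult.right_neutral mult.commute mult_eq_0_iff)
qed

lemma rat_minpoly_eq: "rat_minpoly \<alpha> = smult (1 / of_int (lead_coeff P)) (ipoly P)"
  (is "_ = ?R")
  unfolding rat_minpoly_def
proof (rule the_equality)
  have l: "rat_of_int (lead_coeff P) \<noteq> 0" using nonzero by simp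
  have "?R = [:1 / of_int (lead_coeff P):] * ipoly P" by simp
  moreover have "[:1 / rat_of_int (lead_coeff P):] dvd 1"
    using l by (simp add: is_unit_const_poly_iff dvd_field_iff)
  ultimately have "irreducible ?R"
    using rat_irreducible irreducible_mult_unit_left by metis
  then show R: "irreducible ?R \<and> poly (rpoly ?R) \<alpha> = 0 \<and> lead_coeff ?R = 1"
    using rat_irreducible rat_root l by (simp add: rpoly_smult coeff_map_poly)
  fix S assume S: "irreducible S \<and> poly (rpoly S) \<alpha> = 0 \<and> lead_coeff S = 1"
  then have "ipoly P dvd S" by (intro rat_dvd_of_root) auto
  then have d: "?R dvd S" using l by (simp add: smult_dvd_iff)
  then obtain T where T: "S = ?R * T" by (auto elim: dvdE)
  then have "T dvd 1" using S R by (metis irreducibleD irreducible_not_unit)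
  then have "S dvd ?R" unfolding T by (metis mult_unit_dvd_iff dvd_refl)
  then show "S = ?R" using d S R by (intro poly_eq_of_mutual_dvd) auto
qed

end

section \<open>The number field generated by a root and its embeddings\<close>

interpretation rat_vec: vector_space "\<lambda>(r::rat) (x::'a::field_char_0). of_rat r * x"
  by unfold_locales (auto simp: algebra_simps of_rat_add of_rat_mult)

lemma is_subfield_of_rat:
  assumes "is_subfield F"
  shows "of_rat r \<in> (F :: 'a::field_char_0 set)"
proof -
  have F: "1 \<in> F" "\<And>x y. x \<in> F \<Longrightarrow> y \<in> F \<Longrightarrow> x - y \<in> F"
    "\<And>x y. x \<in> F \<Longrightarrow> y \<in> F \<Longrightarrow> x * y \<in> F" "\<And>x. x \<in> F \<Longrightarrow> inverse x \<in> F"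
    using assms by (auto simp: is_subfield_def)
  have i: "of_int k \<in> F" for k
  proof (induction k rule: int_induct[where k = 0])
    case base
    show ?case using F(2)[OF F(1) F(1)] by simp
  next
    case (step1 i)
    have "0 - 1 \<in> F" using F(1,2) by (metis diff_self)
    then show ?case using F(2)[OF step1(2), of "0 - 1"] by simp
  next
    case (step2 i)
    then show ?case using F(1,2) by simp
  qed
  obtain a b where "r = of_int a / of_int b" by (metis quotient_of_div surj_pair)
  then have "of_rat r = of_int a * inverse (of_int b :: 'a)"
    by (metis of_rat_divide divide_inverse of_rat_of_int_eq)
  then show ?thesis using F i by simp
qed

lemma is_subfield_poly:
  assumes F: "is_subfield F" and "\<alpha> \<in> F"
  shows "poly (rpoly f) \<alpha> \<in> (F :: 'a::field_char_0 set)"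
proof (induction f)
  case 0
  show ?case using is_subfield_of_rat[OF F, of 0] by simp
next
  case (pCons a f)
  have "x + y \<in> F" if "x \<in> F" "y \<in> F" for x y
  proof -
    have "0 - y \<in> F" using that F is_subfield_of_rat[OF F, of 0] by (auto simp: is_subfield_def)
    then have "x - (0 - y) \<in> F" using that F unfolding is_subfield_def by blast
    then show ?thesis by simp
  qed
  then show ?case
    using pCons assms is_subfield_of_rat[OF F] by (simp add: map_poly_pCons is_subfield_def)
qed

context irreducible_with_root
begin

text \<open>
  The evaluations of rational polynomials at \<open>\<alpha>\<close> are already closed under inverses: if
  \<open>f(\<alpha>) \<noteq> 0\<close> then \<open>f\<close> is coprime to \<open>P\<close>, and a Bezout relation evaluated at \<open>\<alpha>\<close> exhibits the
  inverse of \<open>f(\<alpha>)\<close>.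
\<close>

lemma rat_adjoin_eq: "rat_adjoin \<alpha> = range (\<lambda>f. poly (rpoly f) \<alpha>)" (is "_ = ?K")
proof -
  have "is_subfield ?K"
    unfolding is_subfield_def
  proof (intro conjI ballI)
    show "1 \<in> ?K" by (rule range_eqI[of _ _ 1]) simp
  next
    fix x y assume "x \<in> ?K" "y \<in> ?K"
    then obtain f g where fg: "x = poly (rpoly f) \<alpha>" "y = poly (rpoly g) \<alpha>" by blast
    show "x * y \<in> ?K" by (rule range_eqI[of _ _ "f * g"]) (simp add: fg rpoly_mult)
    show "x - y \<in> ?K" by (rule range_eqI[of _ _ "f - g"]) (simp add: fg rpoly_diff)
  next
    fix x assume "x \<in> ?K"
    then obtain f where f: "x = poly (rpoly f) \<alpha>" by blast
    show "inverse x \<in> ?K"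
    proof (cases "x = 0")
      case True
      then show ?thesis by (intro range_eqI[of _ _ 0]) simp
    next
      case False
      have "\<not> ipoly P dvd f"
        using False rat_root by (auto simp: f rpoly_mult elim!: dvdE)
      then have "coprime (ipoly P) f"
        using rat_irreducible
        by (metis prime_elem_imp_coprime field_poly_irreducible_imp_prime)
      then have "gcd (ipoly P) f = 1" by simp
      then have "fst (bezout_coefficients (ipoly P) f) * ipoly P +
          snd (bezout_coefficients (ipoly P) f) * f = 1"
        using bezout_coefficients_fst_snd[of "ipoly P" f] by simp
      then obtain s t where "s * ipoly P + t * f = 1" by blast
      then have "poly (rpoly (s * ipoly P + t * f)) \<alpha> = 1" by simp
      then have "poly (rpoly t) \<alpha> * x = 1"
        using rat_root by (simp add: rpoly_add rpoly_mult f)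
      then have "inverse x = poly (rpoly t) \<alpha>" using False by (simp add: field_simps)
      then show ?thesis by blast
    qed
  qed
  moreover have "\<alpha> \<in> ?K" by (rule range_eqI[of _ _ "[:0, 1:]"]) (simp add: map_poly_pCons)
  ultimately have "rat_adjoin \<alpha> \<subseteq> ?K" unfolding rat_adjoin_def by (intro hull_minimal) auto
  moreover have "?K \<subseteq> rat_adjoin \<alpha>"
    unfolding rat_adjoin_def hull_def using is_subfield_poly by blast
  ultimately show ?thesis by blast
qed

lemma degree_pos: "degree P > 0"
proof (rule ccontr)
  assume "\<not> degree P > 0"
  then obtain c where c: "P = [:c:]" by (auto elim: degree_eq_zeroE)
  then show False using root nonzero by (simp add: map_poly_pCons)
qed

lemma powers_independent:
  assumes "(\<Sum>i<degree P. of_rat (c i) * \<alpha> ^ i) = 0" "i < degree P"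
  shows "c i = 0"
proof -
  define f where "f = (\<Sum>i<degree P. monom (c i) i)"
  have coeff_f: "coeff f j = (if j < degree P then c j else 0)" for j
    by (simp add: f_def coeff_sum)
  have "rpoly f = (\<Sum>i<degree P. monom (of_rat (c i)) i :: 'a poly)"
    by (rule poly_eqI) (simp add: coeff_map_poly coeff_f coeff_sum)
  then have "poly (rpoly f) \<alpha> = 0"
    using assms(1) by (simp add: poly_sum poly_monom)
  then have "ipoly P dvd f" by (rule rat_dvd_of_root)
  moreover have "degree f < degree P"
    using degree_pos coeff_f by (metis coeff_0 degree_lessI leading_coeff_0_iff)
  ultimately have "f = 0" by (metis degree_ipoly dvd_imp_degree_le not_le)
  then show ?thesis using coeff_f[of i] assms(2) by simp
qed

text \<open>
  The powers \<open>1, \<alpha>, \<dots>, \<alpha>\<^bsup>D-1\<^esup>\<close> with \<open>D = degree P\<close> form a basis: they are independent by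
  minimality of \<open>P\<close>, and they span by division with remainder by \<open>P\<close>.
\<close>

lemma rat_degree_adjoin: "rat_degree (rat_adjoin \<alpha>) = degree P"
proof -
  let ?n = "degree P"
  let ?B = "(\<lambda>i. \<alpha> ^ i) ` {..<?n}"
  have inj: "inj_on (\<lambda>i. \<alpha> ^ i) {..<?n}"
  proof (rule inj_onI, rule ccontr)
    fix i j assume ij: "i \<in> {..<?n}" "j \<in> {..<?n}" "\<alpha> ^ i = \<alpha> ^ j" "i \<noteq> j"
    \<comment> \<open>Coincident powers would give the nontrivial relation \<open>\<alpha>\<^sup>i - \<alpha>\<^sup>j = 0\<close>.\<close>
    let ?c = "\<lambda>k. (if k = i then 1 else 0) - (if k = j then 1 else 0 :: rat)"
    have "(\<Sum>k<?n. of_rat (?c k) * \<alpha> ^ k) =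
        (\<Sum>k<?n. (if k = i then \<alpha> ^ k else 0)) - (\<Sum>k<?n. (if k = j then \<alpha> ^ k else 0))"
      by (subst sum_subtractf[symmetric], rule sum.cong) (auto simp: of_rat_diff)
    also have "\<dots> = 0" using ij by simp
    finally show False using powers_independent[of ?c i] ij by simp
  qed
  have ind: "rat_vec.independent ?B"
  proof (rule rat_vec.independent_if_scalars_zero)
    fix f x assume "(\<Sum>x\<in>?B. of_rat (f x) * x) = 0" and x: "x \<in> ?B"
    then have "(\<Sum>i<?n. of_rat (f (\<alpha> ^ i)) * \<alpha> ^ i) = 0"
      by (simp add: sum.reindex[OF inj])
    then show "f x = 0" using powers_independent[of "\<lambda>i. f (\<alpha> ^ i)"] x by blast
  qed simp
  have sub: "?B \<subseteq> rat_adjoin \<alpha>"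
  proof
    fix x assume "x \<in> ?B"
    then obtain i where "x = \<alpha> ^ i" by blast
    then have "x = poly (rpoly (monom 1 i)) \<alpha>" by (simp add: map_poly_monom poly_monom)
    then show "x \<in> rat_adjoin \<alpha>" unfolding rat_adjoin_eq by blast
  qed
  have span: "rat_adjoin \<alpha> \<subseteq> rat_vec.span ?B"
  proof
    fix x assume "x \<in> rat_adjoin \<alpha>"
    then obtain f where f: "x = poly (rpoly f) \<alpha>" by (auto simp: rat_adjoin_eq)
    define g where "g = f mod ipoly P"
    have "f = (f div ipoly P) * ipoly P + g"
      unfolding g_def by (rule div_mult_mod_eq[symmetric])
    then have "x = poly (rpoly ((f div ipoly P) * ipoly P + g)) \<alpha>" using f by simp
    then have x: "x = poly (rpoly g) \<alpha>"
      using rat_root by (simp add: rpoly_add rpoly_mult)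
    have "degree g < ?n"
      unfolding g_def using degree_mod_less'[of "ipoly P" f] degree_pos nonzero
      by (cases "f mod ipoly P = 0") auto
    then have "degree (rpoly g :: 'a poly) < ?n"
      using map_poly_degree_leq le_less_trans by blast
    then have "x = (\<Sum>i<?n. coeff (rpoly g) i * \<alpha> ^ i)"
      unfolding x poly_altdef
      by (intro sum.mono_neutral_left) (auto simp: coeff_eq_0)
    also have "\<dots> = (\<Sum>i<?n. of_rat (coeff g i) * \<alpha> ^ i)" by (simp add: coeff_map_poly)
    also have "\<dots> \<in> rat_vec.span ?B"
      by (intro rat_vec.span_sum rat_vec.span_scale rat_vec.span_base) auto
    finally show "x \<in> rat_vec.span ?B" .
  qed
  show ?thesis
    unfolding rat_degree_def
    by (rule rat_vec.dim_unique[OF sub span ind]) (simp add: card_image[OF inj])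
qed

text \<open>
  This is what makes the assignment \<open>f(\<alpha>) \<mapsto> f(r)\<close> a well-defined map on \<open>\<rat>(\<alpha>)\<close>.
\<close>

lemma poly_eq_at_other_root:
  fixes r :: "'b::field_char_0"
  assumes "poly (ipoly P) r = 0" "poly (rpoly f) \<alpha> = poly (rpoly g) \<alpha>"
  shows "poly (rpoly f) r = poly (rpoly g) r"
proof -
  have "poly (rpoly (f - g)) \<alpha> = 0" using assms(2) by (simp add: rpoly_diff)
  then obtain T where "f - g = ipoly P * T"
    using rat_dvd_of_root by (metis dvdE)
  then have "poly (rpoly (f - g)) r = poly (rpoly (ipoly P * T)) r" by simp
  also have "\<dots> = 0" using assms(1) by (simp add: rpoly_mult rpoly_ipoly)
  finally show ?thesis by (simp add: rpoly_diff)
qed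

end

lemma embedding_of_rat:
  fixes \<sigma> :: "'a::field_char_0 \<Rightarrow> 'b::field_char_0"
  assumes F: "is_subfield F" and \<sigma>: "\<sigma> \<in> embeddings F"
  shows "\<sigma> (of_rat r) = of_rat r"
proof -
  have one: "\<sigma> 1 = 1" and add: "\<And>x y. x \<in> F \<Longrightarrow> y \<in> F \<Longrightarrow> \<sigma> (x + y) = \<sigma> x + \<sigma> y"
    and mult: "\<And>x y. x \<in> F \<Longrightarrow> y \<in> F \<Longrightarrow> \<sigma> (x * y) = \<sigma> x * \<sigma> y"
    using \<sigma> by (auto simp: embeddings_def)
  have mem: "of_rat q \<in> F" for q using is_subfield_of_rat[OF F] .
  have memi: "of_int k \<in> F" for k using mem[of "of_int k"] by simp
  have i: "\<sigma> (of_int k) = of_int k" for k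
  proof (induction k rule: int_induct[where k = 0])
    case base
    show ?case using add[of 0 0] memi[of 0] by simp
  next
    case (step1 i)
    then show ?case using add[of "of_int i" 1] memi[of i] memi[of 1] one by simp
  next
    case (step2 i)
    then show ?case using add[of "of_int (i - 1)" 1] memi[of "i - 1"] memi[of 1] one
      by (simp add: eq_diff_eq)
  qed
  obtain a b where ab: "quotient_of r = (a, b)" by fastforce
  then have b: "b > 0" and r: "r = of_int a / of_int b"
    by (auto simp: quotient_of_denom_pos quotient_of_div)
  have "(of_rat r :: 'a) * of_int b = of_int a" using b by (simp add: r of_rat_divide)
  then have "\<sigma> (of_rat r) * of_int b = of_int a"
    using mult[OF mem memi, of r b] i by metis
  then show ?thesis using b by (simp add: r of_rat_divide field_simps)
qed

lemma embedding_poly: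
  fixes \<sigma> :: "'a::field_char_0 \<Rightarrow> 'b::field_char_0"
  assumes F: "is_subfield F" and \<sigma>: "\<sigma> \<in> embeddings F" and \<alpha>: "\<alpha> \<in> F"
  shows "\<sigma> (poly (rpoly f) \<alpha>) = poly (rpoly f) (\<sigma> \<alpha>)"
proof (induction f)
  case 0
  show ?case using embedding_of_rat[OF F \<sigma>, of 0] by simp
next
  case (pCons a f)
  have "poly (rpoly f) \<alpha> \<in> F" using is_subfield_poly[OF F \<alpha>] .
  moreover from this have "\<alpha> * poly (rpoly f) \<alpha> \<in> F" using \<alpha> F by (auto simp: is_subfield_def)
  ultimately show ?case
    using pCons \<sigma> \<alpha> is_subfield_of_rat[OF F, of a] embedding_of_rat[OF F \<sigma>, of a]
    by (simp add: map_poly_pCons embeddings_def)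
qed

lemma is_subfield_rat_adjoin: "is_subfield (rat_adjoin \<alpha>)"
  unfolding rat_adjoin_def hull_def by (auto simp: is_subfield_def)

lemma generator_in_rat_adjoin: "\<alpha> \<in> rat_adjoin \<alpha>"
  unfolding rat_adjoin_def by (simp add: hull_inc)

text \<open>
  Turns the sum over embeddings into a sum over the roots of \<open>P\<close>. An embedding fixes \<open>\<rat>\<close>, so
  it is determined by the image of \<open>\<alpha>\<close>, which is a root; conversely a root \<open>r\<close> yields the
  embedding \<open>f(\<alpha>) \<mapsto> f(r)\<close>.
\<close>

lemma (in irreducible_with_root) bij_betw_embeddings_roots:
  "bij_betw (\<lambda>\<sigma>. \<sigma> \<alpha>) (embeddings (rat_adjoin \<alpha>)) {r :: 'b::field_char_0. poly (ipoly P) r = 0}"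
  unfolding bij_betw_def
proof (intro conjI)
  let ?F = "rat_adjoin \<alpha>"
  note pol = embedding_poly[OF is_subfield_rat_adjoin _ generator_in_rat_adjoin]
  show "inj_on (\<lambda>\<sigma>. \<sigma> \<alpha>) (embeddings ?F :: ('a \<Rightarrow> 'b) set)"
  proof (rule inj_onI)
    fix \<sigma> \<tau> :: "'a \<Rightarrow> 'b"
    assume st: "\<sigma> \<in> embeddings ?F" "\<tau> \<in> embeddings ?F" "\<sigma> \<alpha> = \<tau> \<alpha>"
    show "\<sigma> = \<tau>"
    proof (rule extensionalityI)
      show "\<sigma> \<in> extensional ?F" "\<tau> \<in> extensional ?F" using st by (auto simp: embeddings_def)
      fix x assume "x \<in> ?F"
      then obtain f where "x = poly (rpoly f) \<alpha>" by (auto simp: rat_adjoin_eq)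
      then show "\<sigma> x = \<tau> x" using pol[OF st(1), of f] pol[OF st(2), of f] st(3) by simp
    qed
  qed
  show "(\<lambda>\<sigma>. \<sigma> \<alpha>) ` embeddings ?F = {r :: 'b. poly (ipoly P) r = 0}"
  proof (intro equalityI subsetI)
    fix r :: 'b assume "r \<in> (\<lambda>\<sigma>. \<sigma> \<alpha>) ` embeddings ?F"
    then obtain \<sigma> where s: "\<sigma> \<in> embeddings ?F" "r = \<sigma> \<alpha>" by blast
    have "poly (ipoly P) r = \<sigma> 0"
      using pol[OF s(1), of "ipoly P"] root s(2) by (simp add: rpoly_ipoly)
    also have "\<dots> = 0" using pol[OF s(1), of 0] by simp
    finally show "r \<in> {r. poly (ipoly P) r = 0}" by simp
  next
    fix r :: 'b assume "r \<in> {r. poly (ipoly P) r = 0}"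
    then have r: "poly (ipoly P) r = 0" by simp
    define \<sigma> where "\<sigma> = restrict (\<lambda>x. poly (rpoly (SOME f. poly (rpoly f) \<alpha> = x)) r) ?F"
    have s: "\<sigma> (poly (rpoly f) \<alpha>) = poly (rpoly f) r" for f
    proof -
      have "poly (rpoly (SOME g. poly (rpoly g) \<alpha> = poly (rpoly f) \<alpha>)) \<alpha> = poly (rpoly f) \<alpha>"
        by (rule someI[of _ f]) simp
      from poly_eq_at_other_root[OF r this] show ?thesis
        by (simp add: \<sigma>_def rat_adjoin_eq)
    qed
    have "\<sigma> \<in> embeddings ?F"
      unfolding embeddings_def
    proof (intro CollectI conjI ballI)
      show "\<sigma> \<in> extensional ?F" by (simp add: \<sigma>_def)
      show "\<sigma> 1 = 1" using s[of 1] by simp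
      fix x y assume "x \<in> ?F" "y \<in> ?F"
      then obtain f g where fg: "x = poly (rpoly f) \<alpha>" "y = poly (rpoly g) \<alpha>"
        by (auto simp: rat_adjoin_eq)
      show "\<sigma> (x + y) = \<sigma> x + \<sigma> y" using s[of "f + g"] s[of f] s[of g] by (simp add: fg rpoly_add)
      show "\<sigma> (x * y) = \<sigma> x * \<sigma> y" using s[of "f * g"] s[of f] s[of g] by (simp add: fg rpoly_mult)
    qed
    moreover have "\<sigma> \<alpha> = r" using s[of "[:0, 1:]"] by (simp add: map_poly_pCons)
    ultimately show "r \<in> (\<lambda>\<sigma>. \<sigma> \<alpha>) ` embeddings ?F" by blast
  qed
qed

text \<open>
  A multiple root would be a root of the derivative, a nonzero polynomial of smaller degree,
  contradicting the minimality of \<open>P\<close>. Hence the embeddings run over the roots of \<open>P\<close> with the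
  multiplicities of its linear factorization.
\<close>

lemma (in irreducible_with_root) roots_simple:
  "rsquarefree (ipoly P :: 'b::field_char_0 poly)"
  unfolding rsquarefree_roots
proof (intro allI notI, elim conjE)
  fix r :: 'b assume r: "poly (ipoly P) r = 0" and d: "poly (pderiv (ipoly P)) r = 0"
  interpret r: irreducible_with_root P r using irred r by unfold_locales
  have "pderiv (ipoly P) = (ipoly (pderiv P) :: 'b poly)"
    by (rule poly_eqI) (simp add: coeff_map_poly coeff_pderiv)
  then have "P dvd pderiv P" using d by (intro r.dvd_of_root) simp
  moreover have "pderiv P \<noteq> 0" using degree_pos by (simp add: pderiv_eq_0_iff)
  ultimately have "degree P \<le> degree (pderiv P)" by (rule dvd_imp_degree_le)
  then show False using degree_pos by (simp add: degree_pderiv)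
qed

lemma rsquarefree_poly_eq_prod_roots:
  fixes p :: "'a::alg_closed_field poly"
  assumes "rsquarefree p"
  shows "poly p x = lead_coeff p * (\<Prod>r | poly p r = 0. x - r)"
proof -
  have p0: "p \<noteq> 0" using assms by (auto simp: rsquarefree_def)
  obtain A where A: "p = smult (lead_coeff p) (\<Prod>x\<in>#A. [:- x, 1:])"
    using alg_closed_imp_factorization[OF p0] by blast
  have "proots (\<Prod>x\<in>#A. [:- x, 1:]) = A"
  proof (induction A)
    case (add x A)
    have "(\<Prod>x\<in>#A. [:- x, 1:]) \<noteq> 0" by (auto simp: prod_mset_zero_iff)
    then have "proots ([:- x, 1:] * (\<Prod>x\<in>#A. [:- x, 1:])) = add_mset x A"
      by (subst proots_mult) (simp_all only: add.IH proots_linear_factor, auto)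
    then show ?case by simp
  qed simp
  moreover have "proots p = proots (smult (lead_coeff p) (\<Prod>x\<in>#A. [:- x, 1:]))" using A by simp
  ultimately have pA: "proots p = A" using p0 by simp
  have "A = mset_set {r. poly p r = 0}"
  proof (rule multiset_eqI)
    fix r
    show "count A r = count (mset_set {r. poly p r = 0}) r"
      using p0 assms rsquarefree_root_order[OF assms, of r] poly_roots_finite[OF p0]
      by (cases "poly p r = 0") (auto simp: pA[symmetric] order_root)
  qed
  then have "p = smult (lead_coeff p) (\<Prod>r | poly p r = 0. [:- r, 1:])"
    using A by (simp add: prod_unfold_prod_mset)
  then have "poly p x = poly (smult (lead_coeff p) (\<Prod>r | poly p r = 0. [:- r, 1:])) x" by simp
  then show ?thesis by (simp add: poly_prod)
qed

section \<open>Eisenstein polynomials and their reciprocals\<close>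

text \<open>
  Suppose \<open>P = f g\<close>. The prime \<open>q\<close> divides exactly one of the two constant coefficients, say that
  of \<open>f\<close>. If \<open>i\<close> is the least index with \<open>q\<close> not dividing the \<open>i\<close>-th coefficient of \<open>f\<close>, then
  \<open>q\<close> does not divide the \<open>i\<close>-th coefficient of \<open>P\<close>. This forces \<open>i = degree P\<close>, so \<open>g\<close> is a
  constant, and it is a unit because \<open>P\<close> is primitive.
\<close>

lemma eisenstein:
  fixes P :: "int poly"
  assumes q: "prime q" and cont: "content P = 1" and deg: "degree P > 0"
    and lead: "\<not> q dvd lead_coeff P"
    and low: "\<And>i. i < degree P \<Longrightarrow> q dvd coeff P i"
    and const: "\<not> q * q dvd coeff P 0"
  shows "irreducible P"
proof -
  have key: "g dvd 1" if fg: "P = f * g" and f0: "q dvd coeff f 0" and g0: "\<not> q dvd coeff g 0" for f g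
  proof -
    have nz: "f \<noteq> 0" "g \<noteq> 0" using fg deg by auto
    have "\<not> q dvd lead_coeff f" using lead fg by (auto simp: lead_coeff_mult)
    then have ex: "\<exists>i. \<not> q dvd coeff f i" by blast
    define i where "i = (LEAST i. \<not> q dvd coeff f i)"
    have i: "\<not> q dvd coeff f i" and less: "\<And>j. j < i \<Longrightarrow> q dvd coeff f j"
      unfolding i_def using LeastI_ex[OF ex] not_less_Least by blast+
    have "coeff P i = (\<Sum>j<i. coeff f j * coeff g (i - j)) + coeff f i * coeff g 0"
      by (simp add: fg coeff_mult flip: lessThan_Suc_atMost)
    moreover have "q dvd (\<Sum>j<i. coeff f j * coeff g (i - j))"
      using less by (intro dvd_sum) auto
    moreover have "\<not> q dvd coeff f i * coeff g 0"
      using i g0 q by (simp add: prime_dvd_mult_iff)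
    ultimately have "\<not> q dvd coeff P i" by (simp add: dvd_add_right_iff)
    then have "degree P \<le> i" using low not_le by blast
    moreover have "i \<le> degree f" using i by (metis coeff_eq_0 dvd_0_right not_le)
    moreover have "degree P = degree f + degree g" using fg nz by (simp add: degree_mult_eq)
    ultimately have "degree g = 0" by simp
    then obtain c where c: "g = [:c:]" by (auto elim: degree_eq_zeroE)
    then have "content g dvd content P" unfolding fg by (simp add: content_mult)
    then show ?thesis using cont c by (simp add: is_unit_const_poly_iff)
  qed
  show ?thesis
  proof (rule irreducibleI)
    show "P \<noteq> 0" using deg by auto
    show "\<not> P dvd 1" using deg by (auto simp: is_unit_poly_iff)
    fix f g assume fg: "P = f * g"
    then have c0: "coeff P 0 = coeff f 0 * coeff g 0" by (simp add: coeff_mult_0)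
    have "q dvd coeff f 0 * coeff g 0" using low[OF deg] c0 by simp
    then have "q dvd coeff f 0 \<or> q dvd coeff g 0" using q by (simp add: prime_dvd_mult_iff)
    moreover have "\<not> (q dvd coeff f 0 \<and> q dvd coeff g 0)"
      using const c0 by (auto intro: mult_dvd_mono)
    ultimately show "f dvd 1 \<or> g dvd 1"
      using key[of f g] key[of g f] fg by (auto simp: mult.commute)
  qed
qed

text \<open>
  Reversing the coefficients is multiplicative, and an involution on polynomials with nonzero
  constant coefficient, so it transports factorizations and units in both directions.
\<close>

lemma irreducible_reflect_poly:
  fixes P :: "int poly"
  assumes "irreducible P" "coeff P 0 \<noteq> 0"
  shows "irreducible (reflect_poly P)"
proof (rule irreducibleI)
  show "reflect_poly P \<noteq> 0" using assms by auto
  show "\<not> reflect_poly P dvd 1"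
  proof
    assume "reflect_poly P dvd 1"
    then obtain T where "1 = reflect_poly P * T" by blast
    then have "reflect_poly 1 = reflect_poly (reflect_poly P * T)" by simp
    then have "1 = P * reflect_poly T" using assms(2) by (simp add: reflect_poly_mult)
    then show False using assms(1) by (metis dvd_triv_left irreducible_not_unit)
  qed
  have unit: "a dvd 1" if "reflect_poly a dvd 1" "coeff a 0 \<noteq> 0" for a :: "int poly"
  proof -
    obtain T where "1 = reflect_poly a * T" using \<open>reflect_poly a dvd 1\<close> by blast
    then have "reflect_poly 1 = reflect_poly (reflect_poly a * T)" by simp
    then have "1 = a * reflect_poly T" using that(2) by (simp add: reflect_poly_mult)
    then show ?thesis by (metis dvd_triv_left)
  qed
  fix a b assume ab: "reflect_poly P = a * b"
  have "coeff (reflect_poly P) 0 \<noteq> 0" using assms by auto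
  then have "coeff a 0 \<noteq> 0" "coeff b 0 \<noteq> 0" by (auto simp: ab coeff_mult_0)
  moreover have "P = reflect_poly a * reflect_poly b"
    using arg_cong[OF ab, of reflect_poly] assms(2) by (simp add: reflect_poly_mult)
  then have "reflect_poly a dvd 1 \<or> reflect_poly b dvd 1"
    using assms(1) irreducibleD by blast
  ultimately show "a dvd 1 \<or> b dvd 1" using unit by blast
qed

lemma poly_ipoly_reflect:
  fixes x :: "'a::field_char_0"
  assumes "x \<noteq> 0"
  shows "poly (ipoly (reflect_poly P)) x = x ^ degree P * poly (ipoly P) (inverse x)"
proof -
  have "ipoly (reflect_poly P) = (reflect_poly (ipoly P) :: 'a poly)"
    by (rule poly_eqI) (simp add: coeff_map_poly coeff_reflect_poly)
  then show ?thesis using assms by (simp add: poly_reflect_poly_nz)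
qed

text \<open>
  For \<open>z\<close> on the unit circle the conjugate of \<open>z\<close> is its inverse. So if \<open>z\<close> is a root of \<open>P\<close>,
  it is also a root of the reciprocal polynomial. By irreducibility \<open>P\<close> divides its reciprocal,
  and comparing leading and constant coefficients shows that they divide each other. This is
  what keeps the logarithm in the Mahler measure free of singularities below.
\<close>

lemma irreducible_no_root_on_circle:
  fixes P :: "int poly"
  assumes irr: "irreducible P" and neq: "\<bar>lead_coeff P\<bar> \<noteq> \<bar>coeff P 0\<bar>" and z: "cmod z = 1"
  shows "poly (ipoly P) z \<noteq> 0"
proof
  assume root: "poly (ipoly P) z = 0"
  then interpret irreducible_with_root P z using irr by unfold_locales
  have z0: "z \<noteq> 0" using z by auto
  have "z * cnj z = 1" using complex_norm_square[of z] z by simp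
  then have "inverse z = cnj z" by (rule inverse_unique)
  moreover have "poly (ipoly P) (cnj z) = cnj (poly (ipoly P) z)"
    by (rule poly_cnj_real[symmetric]) (simp add: coeff_map_poly)
  ultimately have "poly (ipoly (reflect_poly P)) z = 0"
    using root z0 by (simp add: poly_ipoly_reflect)
  then have d: "P dvd reflect_poly P" by (rule dvd_of_root)
  then obtain T where T: "reflect_poly P = P * T" by blast
  have "coeff P 0 \<noteq> 0"
  proof
    assume "coeff P 0 = 0"
    then have "[:0, 1:] dvd P" by (metis poly_eq_0_iff_dvd poly_0_coeff_0 minus_zero)
    then obtain S where S: "P = [:0, 1:] * S" by blast
    then have "S dvd 1" using irr irreducibleD[of P "[:0, 1:]" S]
      by (auto simp: is_unit_poly_iff)
    then obtain c where "S = [:c:]" by (auto simp: is_unit_poly_iff)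
    then show False using root z0 nonzero S by (simp add: map_poly_pCons)
  qed
  then have "lead_coeff (reflect_poly P) = coeff P 0" by (simp add: coeff_reflect_poly)
  then have "lead_coeff P dvd coeff P 0" using T by (metis lead_coeff_mult dvd_triv_left)
  moreover have "coeff P 0 dvd lead_coeff P"
    using T by (metis coeff_0_reflect_poly coeff_mult_0 dvd_triv_left)
  ultimately show False using neq zdvd_antisym_abs by blast
qed

section \<open>Jensen's formula away from the unit circle\<close>

abbreviation unit_circle :: "real \<Rightarrow> complex" where
  "unit_circle t \<equiv> exp (2 * of_real pi * \<i> * of_real t)"

lemma norm_unit_circle: "cmod (unit_circle t) = 1"
  by (simp add: norm_exp_eq_Re)

lemma has_integral_const_unit: "((\<lambda>_. c) has_integral c) {0..1::real}"
  for c :: real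
  using has_integral_const_real[of c 0 1] by simp

text \<open>
  The mean value property of the harmonic function \<open>Re (Ln (1 - a w))\<close> on the unit disc, whose
  value at the centre is \<open>0\<close>.
\<close>

lemma integral_ln_one_minus:
  assumes "cmod a < 1"
  shows "((\<lambda>t. ln (cmod (1 - a * unit_circle t))) has_integral 0) {0..1}"
proof -
  define f where "f w = Ln (1 - a * w)" for w
  have ne: "1 - a * w \<notin> \<real>\<^sub>\<le>\<^sub>0" if "w \<in> cball 0 1" for w
  proof -
    have "cmod (a * w) < 1"
      using that assms by (simp add: norm_mult) (metis mult_left_le norm_ge_zero le_less_trans)
    then have "Re (a * w) < 1" using complex_Re_le_cmod le_less_trans by blast
    then show ?thesis by (auto simp: complex_nonpos_Reals_iff)
  qed
  have "f holomorphic_on cball 0 1"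
    unfolding f_def using ne by (intro holomorphic_intros) auto
  then have "((\<lambda>u. f u / (u - 0)) has_contour_integral 2 * of_real pi * \<i> * f 0) (circlepath 0 1)"
    by (rule Cauchy_integral_circlepath_simple) simp
  then have I: "((\<lambda>t. f (circlepath 0 1 t) / circlepath 0 1 t *
      vector_derivative (circlepath 0 1) (at t within {0..1})) has_integral 0) {0..1}"
    by (simp add: has_contour_integral_def f_def)
  have E: "f (circlepath 0 1 t) / circlepath 0 1 t *
      vector_derivative (circlepath 0 1) (at t within {0..1}) =
      (2 * of_real pi * \<i>) * f (unit_circle t)" if "t \<in> {0..1}" for t
    using that by (subst vector_derivative_circlepath01) (auto simp: circlepath)
  have "((\<lambda>t. (2 * of_real pi * \<i>) * f (unit_circle t)) has_integral 0) {0..1}"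
    by (rule has_integral_eq[OF E I])
  then have "((\<lambda>t. f (unit_circle t)) has_integral 0) {0..1}"
    by (simp add: has_integral_mult_right_iff)
  from has_integral_linear[OF this bounded_linear_Re]
  have "((\<lambda>t. Re (f (unit_circle t))) has_integral 0) {0..1}"
    by (simp add: o_def)
  moreover have "Re (f (unit_circle t)) = ln (cmod (1 - a * unit_circle t))" for t
  proof -
    have "1 - a * unit_circle t \<noteq> 0"
      using ne[of "unit_circle t"] norm_unit_circle[of t] by force
    then show ?thesis by (simp add: f_def)
  qed
  ultimately show ?thesis by simp
qed

text \<open>
  Reduces to the mean value property: on the circle \<open>|w - z| = |1 - cnj z w|\<close>, which serves
  for \<open>|z| < 1\<close>; for \<open>|z| > 1\<close> the factor \<open>|z|\<close> is taken out first.
\<close>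

lemma integral_ln_linear_factor:
  assumes "cmod z \<noteq> 1"
  shows "((\<lambda>t. ln (cmod (unit_circle t - z))) has_integral ln (max 1 (cmod z))) {0..1}"
proof (cases "cmod z < 1")
  case True
  have "cmod (unit_circle t - z) = cmod (1 - cnj z * unit_circle t)" for t
  proof -
    have "cnj (unit_circle t) * unit_circle t = 1"
      by (simp add: exp_cnj flip: exp_add)
    then have "1 - cnj z * unit_circle t = unit_circle t * cnj (unit_circle t - z)"
      by (simp add: algebra_simps)
    then show ?thesis by (simp only: norm_mult norm_unit_circle complex_mod_cnj mult_1)
  qed
  then show ?thesis using integral_ln_one_minus[of "cnj z"] True by simp
next
  case False
  then have z: "cmod z > 1" using assms by simp
  then have z0: "z \<noteq> 0" by auto
  have "ln (cmod (unit_circle t - z)) = ln (cmod z) + ln (cmod (1 - inverse z * unit_circle t))" for t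
  proof -
    have "unit_circle t - z = - z * (1 - inverse z * unit_circle t)"
      using z0 by (simp add: algebra_simps)
    then have "cmod (unit_circle t - z) = cmod z * cmod (1 - inverse z * unit_circle t)"
      by (simp only: norm_mult norm_minus_cancel)
    moreover have "unit_circle t \<noteq> z" using norm_unit_circle[of t] z by auto
    then have "1 - inverse z * unit_circle t \<noteq> 0" using z0 by (simp add: field_simps)
    ultimately show ?thesis using z0 by (simp add: ln_mult)
  qed
  moreover have "cmod (inverse z) < 1" using z by (simp only: norm_inverse inverse_less_1_iff) simp
  then have "((\<lambda>t. ln (cmod z) + ln (cmod (1 - inverse z * unit_circle t))) has_integral
      ln (cmod z) + 0) {0..1}"
    by (intro has_integral_add integral_ln_one_minus has_integral_const_unit)
  ultimately show ?thesis using z by simp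
qed

lemma jensen_formula_prod:
  assumes "\<And>z. z \<in># A \<Longrightarrow> cmod z \<noteq> 1"
  shows "((\<lambda>t. ln (cmod (\<Prod>z\<in>#A. unit_circle t - z))) has_integral (\<Sum>z\<in>#A. ln (max 1 (cmod z)))) {0..1}"
  using assms
proof (induction A)
  case (add z A)
  have nz: "unit_circle t - w \<noteq> 0" if "w \<in># add_mset z A" for w t
    using add.prems[OF that] norm_unit_circle[of t] by auto
  have "(\<Prod>w\<in>#A. unit_circle t - w) \<noteq> 0" for t
    using nz[of _ t] by (auto simp: prod_mset_zero_iff)
  then have "ln (cmod (\<Prod>w\<in>#add_mset z A. unit_circle t - w)) =
      ln (cmod (unit_circle t - z)) + ln (cmod (\<Prod>w\<in>#A. unit_circle t - w))" for t
    using nz[of z t] by (simp add: norm_mult ln_mult)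
  moreover have "((\<lambda>t. ln (cmod (unit_circle t - z)) + ln (cmod (\<Prod>w\<in>#A. unit_circle t - w))) has_integral
      ln (max 1 (cmod z)) + (\<Sum>z\<in>#A. ln (max 1 (cmod z)))) {0..1}"
    using add by (intro has_integral_add integral_ln_linear_factor) auto
  ultimately show ?case by simp
qed simp

text \<open>
  The lower bound is Jensen's formula for \<open>P = a \<Prod> (X - z)\<close>, which gives
  \<open>ln |a| + \<Sum> ln (max 1 |z|)\<close> with \<open>|a| \<ge> 1\<close>; the upper bound only uses a bound of \<open>P\<close> on the circle.
\<close>

lemma log_mahler_bounds:
  fixes P :: "int poly"
  assumes P: "P \<noteq> 0"
    and no_root: "\<And>z. cmod z = 1 \<Longrightarrow> poly (ipoly P) z \<noteq> 0"
    and bound: "\<And>z. cmod z = 1 \<Longrightarrow> cmod (poly (ipoly P) z) \<le> C"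
  shows "0 \<le> log_mahler P" "log_mahler P \<le> ln C"
proof -
  define p where "p = (ipoly P :: complex poly)"
  have p0: "p \<noteq> 0" using P by (simp add: p_def)
  obtain A where A: "p = smult (lead_coeff p) (\<Prod>x\<in>#A. [:- x, 1:])"
    using alg_closed_imp_factorization[OF p0] by blast
  have ev: "poly p w = lead_coeff p * (\<Prod>x\<in>#A. w - x)" for w
  proof -
    have "poly (\<Prod>x\<in>#A. [:- x, 1:]) w = (\<Prod>x\<in>#A. w - x)"
      by (induction A) (auto simp: algebra_simps)
    then show ?thesis by (metis A poly_smult)
  qed
  have A1: "cmod z \<noteq> 1" if "z \<in># A" for z
  proof
    assume "cmod z = 1"
    moreover have "poly p z = 0" using that by (auto simp: ev prod_mset_zero_iff)
    ultimately show False using no_root by (simp add: p_def)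
  qed
  have lead: "\<bar>lead_coeff P\<bar> \<ge> 1" using P by (metis leading_coeff_0_iff int_one_le_iff_zero_less zero_less_abs_iff)
  have "cmod (lead_coeff p) = \<bar>lead_coeff P\<bar>" by (simp add: p_def coeff_map_poly)
  then have lead': "cmod (lead_coeff p) \<ge> 1" using lead by simp
  let ?I = "ln (cmod (lead_coeff p)) + (\<Sum>z\<in>#A. ln (max 1 (cmod z)))"
  have "((\<lambda>t. ln (cmod (lead_coeff p)) + ln (cmod (\<Prod>z\<in>#A. unit_circle t - z))) has_integral
      ln (cmod (lead_coeff p)) + (\<Sum>z\<in>#A. ln (max 1 (cmod z)))) {0..1}"
    using A1 by (intro has_integral_add jensen_formula_prod has_integral_const_unit)
  moreover have "ln (cmod (poly p (unit_circle t))) =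
      ln (cmod (lead_coeff p)) + ln (cmod (\<Prod>z\<in>#A. unit_circle t - z))" for t
    using no_root[OF norm_unit_circle, of t] by (simp add: p_def[symmetric] ev norm_mult ln_mult)
  ultimately have int: "((\<lambda>t. ln (cmod (poly p (unit_circle t)))) has_integral ?I) {0..1}" by simp
  then have eq: "log_mahler P = ?I"
    unfolding log_mahler_def p_def by (rule integral_unique)
  have "(\<Sum>z\<in>#A. ln (max 1 (cmod z))) \<ge> 0"
    by (induction A) auto
  then show "0 \<le> log_mahler P" using lead' eq by (simp add: ln_ge_zero)
  have "?I \<le> ln C"
  proof (rule has_integral_le[OF int has_integral_const_unit])
    fix t :: real
    have "0 < cmod (poly p (unit_circle t))" using no_root[OF norm_unit_circle, of t] by (simp add: p_def)
    moreover have "cmod (poly p (unit_circle t)) \<le> C" using bound[OF norm_unit_circle, of t] by (simp add: p_def)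
    ultimately show "ln (cmod (poly p (unit_circle t))) \<le> ln C" by (intro ln_mono) auto
  qed
  then show "log_mahler P \<le> ln C" using eq by simp
qed

section \<open>Averages of an absolute value over the embeddings\<close>

context
  fixes v :: "'a::field \<Rightarrow> real"
  assumes v: "absolute_value v"
begin

lemma absolute_value_mult: "v (x * y) = v x * v y"
  using v by (simp add: absolute_value_def)

lemma absolute_value_pos: "x \<noteq> 0 \<Longrightarrow> v x > 0"
  using v by (metis absolute_value_def order_le_less)

lemma absolute_value_1: "v 1 = 1"
  using absolute_value_mult[of 1 1] absolute_value_pos[of 1] by simp

lemma absolute_value_power: "v (x ^ n) = v x ^ n"
  by (induction n) (simp_all add: absolute_value_1 absolute_value_mult)

lemma absolute_value_prod: "v (prod f A) = (\<Prod>x\<in>A. v (f x))"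
  by (induction A rule: infinite_finite_induct)
     (simp_all add: absolute_value_1 absolute_value_mult)

lemma absolute_value_minus_commute: "v (x - y) = v (y - x)"
proof -
  have "v (-1) * v (-1) = 1"
    by (simp flip: absolute_value_mult add: absolute_value_1)
  then have "v (-1) = 1"
    using absolute_value_pos[of "-1"] by (simp add: square_eq_1_iff)
  then show ?thesis
    using absolute_value_mult[of "-1" "y - x"] by simp
qed

end

text \<open>
  The embeddings map \<open>\<alpha>\<close> to the simple roots of \<open>P\<close>, and
  \<open>P(\<kappa>) = a \<Prod> (\<kappa> - r)\<close> with leading coefficient \<open>a\<close>. So the sum only
  depends on \<open>P(\<kappa>)\<close> and \<open>a\<close>, and no root has to be located.
\<close>

lemma (in irreducible_with_root) sum_ln_embeddings:
  fixes v :: "'b::{alg_closed_field, field_char_0} \<Rightarrow> real"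
  assumes v: "absolute_value v" and \<kappa>: "poly (ipoly P) \<kappa> \<noteq> 0"
  shows "(\<Sum>\<sigma>\<in>embeddings (rat_adjoin \<alpha>). ln (v (\<sigma> \<alpha> - \<kappa>))) =
    ln (v (poly (ipoly P) \<kappa>) / v (of_int (lead_coeff P)))"
proof -
  let ?R = "{r :: 'b. poly (ipoly P) r = 0}"
  have fin: "finite ?R" using nonzero by (intro poly_roots_finite) simp
  have "(\<Sum>\<sigma>\<in>embeddings (rat_adjoin \<alpha>). ln (v (\<sigma> \<alpha> - \<kappa>))) = (\<Sum>r\<in>?R. ln (v (r - \<kappa>)))"
    by (rule sum.reindex_bij_betw[OF bij_betw_embeddings_roots])
  also have "\<dots> = (\<Sum>r\<in>?R. ln (v (\<kappa> - r)))"
    using absolute_value_minus_commute[OF v] by metis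
  also have "\<dots> = ln (\<Prod>r\<in>?R. v (\<kappa> - r))"
  proof (rule ln_prod[symmetric, OF fin])
    fix r assume "r \<in> ?R"
    then have "\<kappa> - r \<noteq> 0" using \<kappa> by auto
    then show "v (\<kappa> - r) \<noteq> 0" using absolute_value_pos[OF v] less_irrefl by metis
  qed
  also have "(\<Prod>r\<in>?R. v (\<kappa> - r)) = v (\<Prod>r\<in>?R. \<kappa> - r)"
    by (simp add: absolute_value_prod[OF v])
  also have "v (\<Prod>r\<in>?R. \<kappa> - r) = v (poly (ipoly P) \<kappa>) / v (of_int (lead_coeff P))"
  proof -
    have "poly (ipoly P) \<kappa> = of_int (lead_coeff P) * (\<Prod>r\<in>?R. \<kappa> - r)"
      using rsquarefree_poly_eq_prod_roots[OF roots_simple, of \<kappa>]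
      by (simp add: coeff_map_poly)
    moreover have "v (of_int (lead_coeff P)) > 0"
      using nonzero by (intro absolute_value_pos[OF v]) simp
    ultimately show ?thesis by (simp add: absolute_value_mult[OF v])
  qed
  finally show ?thesis .
qed

section \<open>Sequences of small height\<close>

text \<open>
  Suppose the irreducible polynomials \<open>P\<^sub>n\<close> have growing degree, are uniformly bounded on the unit
  circle, and have leading and constant coefficients of different size. Then any choice of roots
  is a strict sequence with heights tending to zero: the height is the logarithmic
  Mahler measure, which stays bounded, divided by the degree. So a prescribed limit of the
  averages over the embeddings can be achieved by prescribing the values \<open>P\<^sub>n(\<kappa>)\<close>
  and the leading coefficients.
\<close>

lemma small_height_sequence:
  fixes v :: "'a::{alg_closed_field, field_char_0} \<Rightarrow> real" and P :: "nat \<Rightarrow> int poly"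
  assumes v: "absolute_value v" and alg: "algebraic \<kappa>"
    and irr: "\<And>n. irreducible (P n)" and lead: "\<And>n. lead_coeff (P n) \<ge> 1"
    and neq: "\<And>n. lead_coeff (P n) \<noteq> \<bar>coeff (P n) 0\<bar>"
    and deg: "\<And>n. degree (P n) = n + N"
    and bound: "\<And>n z. cmod z = 1 \<Longrightarrow> cmod (poly (ipoly (P n)) z) \<le> C"
    and val: "\<And>n. poly (ipoly (P n)) \<kappa> \<noteq> 0"
    and lim: "(\<lambda>n. ln (v (poly (ipoly (P n)) \<kappa>) / v (of_int (lead_coeff (P n)))) / real (n + N)) \<longlonglongrightarrow> L"
    and N: "N > 0"
  shows "\<exists>\<alpha> :: nat \<Rightarrow> 'a.
      (\<forall>n. algebraic (\<alpha> n)) \<and> strict_seq \<alpha> \<and> (\<forall>n. \<not> conjugates (\<alpha> n) \<kappa>) \<and>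
      (\<lambda>n. weil_height (\<alpha> n)) \<longlonglongrightarrow> 0 \<and>
      (\<lambda>n. 1 / real (rat_degree (rat_adjoin (\<alpha> n))) *
               (\<Sum>\<sigma>\<in>(embeddings (rat_adjoin (\<alpha> n)) :: ('a \<Rightarrow> 'a) set).
                  ln (v (\<sigma> (\<alpha> n) - \<kappa>)))) \<longlonglongrightarrow> L"
proof -
  have "\<exists>x :: 'a. poly (ipoly (P n)) x = 0" for n
    by (rule alg_closed_imp_poly_has_root) (use deg N in simp)
  then obtain \<alpha> :: "nat \<Rightarrow> 'a" where root: "\<And>n. poly (ipoly (P n)) (\<alpha> n) = 0" by metis
  interpret minimal: irreducible_with_root "P n" "\<alpha> n" for n using irr root by unfold_locales
  have minpoly: "int_minpoly (\<alpha> n) = P n" for n using lead by (rule minimal.int_minpoly_eq)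
  have "inj \<alpha>"
  proof (rule injI)
    fix m n assume "\<alpha> m = \<alpha> n"
    then have "degree (P m) = degree (P n)" using minpoly by metis
    then show "m = n" by (simp add: deg)
  qed
  then have "finite {n. \<alpha> n = \<beta>}" for \<beta>
    using finite_vimageI[of "{\<beta>}" \<alpha>] by (simp add: vimage_def)
  then have strict: "strict_seq \<alpha>" by (simp add: strict_seq_def)
  have nconj: "\<not> conjugates (\<alpha> n) \<kappa>" for n
  proof
    assume "conjugates (\<alpha> n) \<kappa>"
    then have eq: "rat_minpoly (\<alpha> n) = rat_minpoly \<kappa>" by (simp add: conjugates_def)
    obtain K where K: "irreducible K" "poly (ipoly K) \<kappa> = 0"
      using int_poly_annihilator[OF alg] by metis
    then interpret K: irreducible_with_root K \<kappa> by unfold_locales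
    have "poly (rpoly (rat_minpoly \<kappa>)) \<kappa> = 0"
      using K.rat_root by (simp add: K.rat_minpoly_eq rpoly_smult)
    then show False
      using val[of n] minimal.nonzero[of n]
      by (simp add: eq[symmetric] minimal.rat_minpoly_eq rpoly_smult rpoly_ipoly)
  qed
  have no_root: "poly (ipoly (P n)) z \<noteq> 0" if "cmod z = 1" for n z
    by (rule irreducible_no_root_on_circle[OF irr _ that]) (use lead[of n] neq[of n] in linarith)
  have height: "weil_height (\<alpha> n) = log_mahler (P n) / real (n + N)" for n
    by (simp add: weil_height_def minpoly deg)
  have "(\<lambda>n. weil_height (\<alpha> n)) \<longlonglongrightarrow> 0"
  proof (rule tendsto_sandwich)
    show "\<forall>\<^sub>F n in sequentially. 0 \<le> weil_height (\<alpha> n)"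
      using log_mahler_bounds(1)[OF minimal.nonzero no_root bound] by (simp add: height)
    show "\<forall>\<^sub>F n in sequentially. weil_height (\<alpha> n) \<le> ln C / real (n + N)"
      using log_mahler_bounds(2)[OF minimal.nonzero no_root bound]
      unfolding height by (intro always_eventually allI divide_right_mono) auto
    show "(\<lambda>n. ln C / real (n + N)) \<longlonglongrightarrow> 0"
      using LIMSEQ_ignore_initial_segment[OF lim_const_over_n[of "ln C"], of N] by simp
  qed simp
  moreover have "(\<lambda>n. 1 / real (rat_degree (rat_adjoin (\<alpha> n))) *
               (\<Sum>\<sigma>\<in>(embeddings (rat_adjoin (\<alpha> n)) :: ('a \<Rightarrow> 'a) set).
                  ln (v (\<sigma> (\<alpha> n) - \<kappa>)))) \<longlonglongrightarrow> L"
    using lim by (simp add: minimal.rat_degree_adjoin minimal.sum_ln_embeddings[OF v val] deg)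
  ultimately show ?thesis using minimal.algebraic strict nconj by blast
qed

text \<open>
  The polynomials are \<open>X\<^sup>m + q B\<close>, where \<open>B\<close> is a fixed integer polynomial vanishing at \<open>x\<close> with
  positive constant coefficient and \<open>q\<close> is a prime exceeding this coefficient. They are
  Eisenstein at \<open>q\<close>, only the term \<open>X\<^sup>m\<close> contributes at \<open>x\<close>, and on the unit circle they are bounded
  independently of \<open>m\<close>.
\<close>

lemma eisenstein_family:
  fixes x :: "'a::field_char_0"
  assumes "algebraic x" "x \<noteq> 0"
  obtains E :: "nat \<Rightarrow> int poly" and N :: nat and c :: int and C :: real
  where "N > 0" "c \<ge> 2" "\<And>n. irreducible (E n)" "\<And>n. degree (E n) = n + N"
    "\<And>n. lead_coeff (E n) = 1" "\<And>n. coeff (E n) 0 = c"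
    "\<And>n. poly (ipoly (E n)) x = x ^ (n + N)"
    "\<And>n z. cmod z = 1 \<Longrightarrow> cmod (poly (ipoly (E n)) z) \<le> C"
proof -
  obtain B0 where B0: "coeff B0 0 \<noteq> 0" "poly (ipoly B0) x = 0"
    using algebraicE'_nonzero[OF assms] by metis
  define B where "B = smult (sgn (coeff B0 0)) B0"
  have B: "coeff B 0 > 0" "poly (ipoly B) x = 0"
    using B0 by (auto simp: B_def ipoly_smult sgn_if)
  obtain q' where q': "prime q'" "nat (coeff B 0) < q'" using bigger_prime by blast
  define q where "q = int q'"
  have q: "prime q" "coeff B 0 < q" using q' by (auto simp: q_def)
  then have q2: "q \<ge> 2" using prime_ge_2_int by blast
  have nd: "\<not> q dvd coeff B 0" using B(1) q(2) zdvd_not_zless by blast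
  define N where "N = Suc (degree B)"
  define E where "E n = monom 1 (n + N) + smult q B" for n
  have co: "coeff (E n) i = (if i = n + N then 1 else q * coeff B i)" for n i
    by (auto simp: E_def N_def coeff_eq_0)
  have deg: "degree (E n) = n + N" for n
  proof -
    have "degree (smult q B) < degree (monom (1::int) (n + N))"
      using degree_smult_le[of q B] by (simp add: degree_monom_eq N_def)
    then show ?thesis unfolding E_def by (simp add: degree_add_eq_left degree_monom_eq)
  qed
  have lead: "lead_coeff (E n) = 1" for n by (simp add: deg co)
  have irr: "irreducible (E n)" for n
  proof (rule eisenstein[OF q(1)])
    have "content (E n) dvd lead_coeff (E n)" by (rule content_dvd_coeff)
    then show "content (E n) = 1"
      unfolding lead using is_unit_content_iff by blast
    show "degree (E n) > 0" by (simp add: deg N_def)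
    show "\<not> q dvd lead_coeff (E n)" unfolding lead using q2 by simp
    show "q dvd coeff (E n) i" if "i < degree (E n)" for i using that by (simp add: co deg)
    show "\<not> q * q dvd coeff (E n) 0" using nd q2 by (simp add: co N_def)
  qed
  have ev: "poly (ipoly (E n)) y = y ^ (n + N) + of_int q * poly (ipoly B) y" for n and y :: "'b::field_char_0"
    by (simp add: E_def ipoly_add ipoly_smult map_poly_monom poly_monom)
  obtain C0 where C0: "\<And>z. cmod z \<le> 1 \<Longrightarrow> cmod (poly (ipoly B) z) \<le> C0"
    using poly_bound_exists[of 1 "ipoly B"] by blast
  have bd: "cmod (poly (ipoly (E n)) z) \<le> 1 + of_int q * C0" if "cmod z = 1" for n z
  proof -
    have "cmod (poly (ipoly (E n)) z) \<le> cmod (z ^ (n + N)) + cmod (of_int q * poly (ipoly B) z)"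
      unfolding ev by (rule norm_triangle_ineq)
    also have "cmod (z ^ (n + N)) = 1" by (simp add: norm_power that)
    also have "cmod (of_int q * poly (ipoly B) z) \<le> of_int q * C0"
      using C0[of z] that q2 by (simp add: norm_mult mult_left_mono)
    finally show ?thesis by simp
  qed
  show thesis
  proof (rule that[of N "q * coeff B 0" E])
    have "q * 1 \<le> q * coeff B 0" using B(1) q2 by (intro mult_left_mono) auto
    then show "q * coeff B 0 \<ge> 2" using q2 by linarith
    show "poly (ipoly (E n)) x = x ^ (n + N)" for n using B(2) by (simp add: ev)
    show "coeff (E n) 0 = q * coeff B 0" for n by (simp add: co N_def)
  qed (use irr deg lead bd in \<open>auto simp: N_def\<close>)
qed

section \<open>The sequence violating equidistribution\<close>

theorem theorem2:
  fixes p :: nat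
    and absQp :: "'q::field_char_0 \<Rightarrow> real"
    and \<iota> :: "'q \<Rightarrow> 'a::{alg_closed_field, field_char_0}"
    and absp :: "'a \<Rightarrow> real"
    and \<kappa> :: 'a
  assumes "prime p"
    and "padic_field p absQp"
    and "algebraic_closure_of \<iota>"
    and "extends_abs \<iota> absQp absp"
    and "algebraic \<kappa>" and "\<kappa> \<noteq> 0" and "absp \<kappa> \<noteq> 1"
  shows "\<exists>\<alpha> :: nat \<Rightarrow> 'a.
      (\<forall>n. algebraic (\<alpha> n)) \<and> strict_seq \<alpha> \<and>
      (\<forall>n. \<not> conjugates (\<alpha> n) \<kappa>) \<and>
      (\<lambda>n. weil_height (\<alpha> n)) \<longlonglongrightarrow> 0 \<and>
      (\<lambda>n. \<bar>1 / real (rat_degree (rat_adjoin (\<alpha> n))) *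
               (\<Sum>\<sigma>\<in>(embeddings (rat_adjoin (\<alpha> n)) :: ('a \<Rightarrow> 'a) set).
                  ln (absp (\<sigma> (\<alpha> n) - \<kappa>)))
             - ln (max 1 (absp \<kappa>))\<bar>) \<longlonglongrightarrow> \<bar>ln (absp \<kappa>)\<bar> \<and>
      \<bar>ln (absp \<kappa>)\<bar> > 0"
proof -
  have v: "absolute_value absp" using assms(4) by (simp add: extends_abs_def)
  note pos = absolute_value_pos[OF v \<open>\<kappa> \<noteq> 0\<close>]
  have positive: "\<bar>ln (absp \<kappa>)\<bar> > 0" using pos assms(7) by simp
  have "\<exists>L \<alpha>. \<bar>L - ln (max 1 (absp \<kappa>))\<bar> = \<bar>ln (absp \<kappa>)\<bar> \<and>
      (\<forall>n. algebraic (\<alpha> n)) \<and> strict_seq \<alpha> \<and> (\<forall>n. \<not> conjugates (\<alpha> n) \<kappa>) \<and>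
      (\<lambda>n. weil_height (\<alpha> n)) \<longlonglongrightarrow> 0 \<and>
      (\<lambda>n. 1 / real (rat_degree (rat_adjoin (\<alpha> n))) *
               (\<Sum>\<sigma>\<in>(embeddings (rat_adjoin (\<alpha> n)) :: ('a \<Rightarrow> 'a) set).
                  ln (absp (\<sigma> (\<alpha> n) - \<kappa>)))) \<longlonglongrightarrow> L"
  proof (cases "absp \<kappa> < 1")
    case True
    \<comment> \<open>For \<open>|\<kappa>| < 1\<close> the value \<open>\<kappa>\<^sup>m\<close> of a monic polynomial of degree \<open>m\<close> gives the average
      \<open>ln |\<kappa>|\<close> exactly, whereas \<open>ln (max 1 |\<kappa>|) = 0\<close>.\<close>
    obtain E N c C where E: "N > 0" "c \<ge> (2::int)" "\<And>n. irreducible (E n)"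
      "\<And>n. degree (E n) = n + N" "\<And>n. lead_coeff (E n) = 1" "\<And>n. coeff (E n) 0 = c"
      "\<And>n. poly (ipoly (E n)) \<kappa> = \<kappa> ^ (n + N)"
      "\<And>n z. cmod z = 1 \<Longrightarrow> cmod (poly (ipoly (E n)) z) \<le> C"
      using eisenstein_family[OF assms(5,6)] by metis
    have "(\<lambda>n. ln (absp (poly (ipoly (E n)) \<kappa>) / absp (of_int (lead_coeff (E n)))) / real (n + N))
        \<longlonglongrightarrow> ln (absp \<kappa>)"
      unfolding E(5,7) absolute_value_power[OF v] using E(1) pos
      by (simp add: absolute_value_1[OF v] ln_realpow)
    from small_height_sequence[OF v assms(5) E(3) _ _ E(4,8) _ this E(1)]
    show ?thesis using True E(2,5,6,7) \<open>\<kappa> \<noteq> 0\<close>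
      by (intro exI[of _ "ln (absp \<kappa>)"]) (simp add: max_def)
  next
    case False
    then have gt: "absp \<kappa> > 1" using assms(7) by simp
    \<comment> \<open>For \<open>|\<kappa>| > 1\<close> the reciprocals of the polynomials belonging to \<open>1/\<kappa>\<close> take the value \<open>1\<close> at
      \<open>\<kappa>\<close> and have a fixed leading coefficient, so the averages tend to \<open>0\<close>
      instead of \<open>ln |\<kappa>|\<close>.\<close>
    have "algebraic (inverse \<kappa>)" "inverse \<kappa> \<noteq> 0" using assms(5,6) by auto
    then obtain E N c C where E: "N > 0" "c \<ge> (2::int)" "\<And>n. irreducible (E n)"
      "\<And>n. degree (E n) = n + N" "\<And>n. lead_coeff (E n) = 1" "\<And>n. coeff (E n) 0 = c"
      "\<And>n. poly (ipoly (E n)) (inverse \<kappa>) = inverse \<kappa> ^ (n + N)"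
      "\<And>n z. cmod z = 1 \<Longrightarrow> cmod (poly (ipoly (E n)) z) \<le> C"
      using eisenstein_family[of "inverse \<kappa>"] by metis
    define P where "P n = reflect_poly (E n)" for n
    have c0: "coeff (E n) 0 \<noteq> 0" for n using E(2,6) by simp
    have P: "irreducible (P n)" "degree (P n) = n + N" "lead_coeff (P n) = c" "coeff (P n) 0 = 1"
      "poly (ipoly (P n)) \<kappa> = 1" for n
    proof -
      show "irreducible (P n)" unfolding P_def by (rule irreducible_reflect_poly[OF E(3) c0])
      show d: "degree (P n) = n + N" using c0 by (simp add: P_def E(4))
      show "lead_coeff (P n) = c" unfolding d by (simp add: P_def coeff_reflect_poly E(4,6))
      show "coeff (P n) 0 = 1" using E(5) by (simp add: P_def)
      show "poly (ipoly (P n)) \<kappa> = 1"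
        using \<open>\<kappa> \<noteq> 0\<close> by (simp add: P_def poly_ipoly_reflect E(4,7) flip: power_mult_distrib)
    qed
    have bound: "cmod (poly (ipoly (P n)) z) \<le> C" if "cmod z = 1" for n z
    proof -
      have "z \<noteq> 0" using that by auto
      then show ?thesis
        using that E(8)[of "inverse z" n]
        by (simp add: P_def poly_ipoly_reflect norm_mult norm_power norm_inverse)
    qed
    have "(\<lambda>n. ln (absp (poly (ipoly (P n)) \<kappa>) / absp (of_int (lead_coeff (P n)))) / real (n + N)) \<longlonglongrightarrow> 0"
      unfolding P(3,5)
      using LIMSEQ_ignore_initial_segment[OF lim_const_over_n[of "ln (absp 1 / absp (of_int c))"], of N]
      by simp
    from small_height_sequence[OF v assms(5) P(1) _ _ P(2) bound _ this E(1)]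
    show ?thesis using gt E(2) P(3,4,5)
      by (intro exI[of _ 0]) (simp add: max_def)
  qed
  then obtain L \<alpha> where L: "\<bar>L - ln (max 1 (absp \<kappa>))\<bar> = \<bar>ln (absp \<kappa>)\<bar>"
    and \<alpha>: "\<forall>n. algebraic (\<alpha> n)" "strict_seq \<alpha>" "\<forall>n. \<not> conjugates (\<alpha> n) \<kappa>"
      "(\<lambda>n. weil_height (\<alpha> n)) \<longlonglongrightarrow> 0"
      "(\<lambda>n. 1 / real (rat_degree (rat_adjoin (\<alpha> n))) *
               (\<Sum>\<sigma>\<in>(embeddings (rat_adjoin (\<alpha> n)) :: ('a \<Rightarrow> 'a) set).
                  ln (absp (\<sigma> (\<alpha> n) - \<kappa>)))) \<longlonglongrightarrow> L"
    by blast
  have "(\<lambda>n. \<bar>1 / real (rat_degree (rat_adjoin (\<alpha> n))) *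
               (\<Sum>\<sigma>\<in>(embeddings (rat_adjoin (\<alpha> n)) :: ('a \<Rightarrow> 'a) set).
                  ln (absp (\<sigma> (\<alpha> n) - \<kappa>)))
             - ln (max 1 (absp \<kappa>))\<bar>) \<longlonglongrightarrow> \<bar>ln (absp \<kappa>)\<bar>"
    unfolding L[symmetric] by (intro tendsto_rabs tendsto_diff \<alpha>(5) tendsto_const)
  then show ?thesis using \<alpha>(1-4) positive by blast
qed

end
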